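(* Let $\alpha:I\to\mathbb{R}^3$ be an arclength parametrized curve with curvature $\kappa_\alpha>0$. Then $\alpha$ is a rectifying helix with $W$ orthogonal to $V$ (that is, there exist a unit $F$-constant rectifying vector field $W$ along $\alpha$ and a nonzero constant vector $V\in\mathbb{R}^3$ with $\langle W(s),V\rangle=0$ for all $s\in I$) if and only if $\alpha$ is a cylindrical helix.
   Context: $I$ is an open interval and all curves and functions are smooth ($C^\infty$). For an arclength parametrized curve $\alpha:I\to\mathbb{R}^3$ with $\kappa_\alpha>0$, the Frenet frame $\{T_\alpha,N_\alpha,B_\alpha\}$ satisfies $T_\alpha'=\kappa_\alpha N_\alpha$, $N_\alpha'=-\kappa_\alpha T_\alpha+\tau_\alpha B_\alpha$, $B_\alpha'=-\tau_\alpha N_\alpha$, where $\tau_\alpha$ is the torsion. A vector field $W$ along $\alpha$ is called $F$-constant (with respect to the Frenet frame) if $W'=D_\alpha\times W$, where $D_\alpha=\tau_\alpha T_\alpha+\kappa_\alpha B_\alpha$ is the Darboux vector; equivalently, $W=aT_\alpha+bN_\alpha+cB_\alpha$ with real constants $a,b,c$. It is rectifying if $W(s)$ lies in the rectifying plane $\mathrm{span}\{T_\alpha(s),B_\alpha(s)\}$ for every $s$. A curve $\alpha$ is a helix if there is a (without loss of generality unit) $F$-constant vector field $W$ along $\alpha$ forming a constant angle with a fixed direction $V$ (a nonzero constant vector), called an axis; it is a rectifying helix if $W$ is a rectifying vector field. A cylindrical helix is a curve whose tangent vector field $T_\alpha$ forms a constant angle with a fixed direction (a nonzero constant vector) in $\mathbb{R}^3$.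 *)

theory Defs
  imports "HOL-Analysis.Analysis"
begin

definition vderiv :: "(real \<Rightarrow> 'a::real_normed_vector) \<Rightarrow> real \<Rightarrow> 'a" where
  "vderiv f t = vector_derivative f (at t)"

(* C-infinity, meant for open I: the derivatives are two-sided, so only the
   values of f on I matter. *)
definition smooth_on :: "real set \<Rightarrow> (real \<Rightarrow> 'a::real_normed_vector) \<Rightarrow> bool" where
  "smooth_on I f \<longleftrightarrow> (\<forall>n. \<forall>t\<in>I. ((vderiv ^^ n) f) differentiable (at t))"

definition arclength_curve :: "real set \<Rightarrow> (real \<Rightarrow> real^3) \<Rightarrow> bool" where
  "arclength_curve I \<alpha> \<longleftrightarrow> smooth_on I \<alpha> \<and> (\<forall>s\<in>I. norm (vderiv \<alpha> s) = 1)"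

(* The Frenet apparatus below is meant for arclength parametrized curves of
   positive curvature. *)

definition tangent :: "(real \<Rightarrow> real^3) \<Rightarrow> real \<Rightarrow> real^3" where
  "tangent \<alpha> s = vderiv \<alpha> s"

definition curvature :: "(real \<Rightarrow> real^3) \<Rightarrow> real \<Rightarrow> real" where
  "curvature \<alpha> s = norm (vderiv (tangent \<alpha>) s)"

definition normal :: "(real \<Rightarrow> real^3) \<Rightarrow> real \<Rightarrow> real^3" where
  "normal \<alpha> s = vderiv (tangent \<alpha>) s /\<^sub>R curvature \<alpha> s"

definition binormal :: "(real \<Rightarrow> real^3) \<Rightarrow> real \<Rightarrow> real^3" where
  "binormal \<alpha> s = cross3 (tangent \<alpha> s) (normal \<alpha> s)"

(* The sign is the one in the Frenet equation B' = - torsion * N. *)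
definition torsion :: "(real \<Rightarrow> real^3) \<Rightarrow> real \<Rightarrow> real" where
  "torsion \<alpha> s = - (vderiv (binormal \<alpha>) s \<bullet> normal \<alpha> s)"

definition darboux :: "(real \<Rightarrow> real^3) \<Rightarrow> real \<Rightarrow> real^3" where
  "darboux \<alpha> s = torsion \<alpha> s *\<^sub>R tangent \<alpha> s + curvature \<alpha> s *\<^sub>R binormal \<alpha> s"

definition F_constant :: "real set \<Rightarrow> (real \<Rightarrow> real^3) \<Rightarrow> (real \<Rightarrow> real^3) \<Rightarrow> bool" where
  "F_constant I \<alpha> W \<longleftrightarrow>
     smooth_on I W \<and> (\<forall>s\<in>I. vderiv W s = cross3 (darboux \<alpha> s) (W s))"

definition rectifying_field :: "real set \<Rightarrow> (real \<Rightarrow> real^3) \<Rightarrow> (real \<Rightarrow> real^3) \<Rightarrow> bool" where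
  "rectifying_field I \<alpha> W \<longleftrightarrow> (\<forall>s\<in>I. W s \<in> span {tangent \<alpha> s, binormal \<alpha> s})"

(* The angle in [0, pi] between two nonzero vectors. *)
definition vec_angle :: "real^3 \<Rightarrow> real^3 \<Rightarrow> real" where
  "vec_angle u v = arccos ((u \<bullet> v) / (norm u * norm v))"

definition constant_angle :: "real set \<Rightarrow> (real \<Rightarrow> real^3) \<Rightarrow> real^3 \<Rightarrow> bool" where
  "constant_angle I W V \<longleftrightarrow> (\<exists>\<theta>. \<forall>s\<in>I. vec_angle (W s) V = \<theta>)"

(* The field W and the axis V are arguments, so that further conditions can be
   imposed on them; the curve is a helix if such W and V exist. *)
definition helix_with ::
    "real set \<Rightarrow> (real \<Rightarrow> real^3) \<Rightarrow> (real \<Rightarrow> real^3) \<Rightarrow> real^3 \<Rightarrow> bool" where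
  "helix_with I \<alpha> W V \<longleftrightarrow>
     F_constant I \<alpha> W \<and> (\<forall>s\<in>I. norm (W s) = 1) \<and> V \<noteq> 0 \<and> constant_angle I W V"

definition rectifying_helix_with ::
    "real set \<Rightarrow> (real \<Rightarrow> real^3) \<Rightarrow> (real \<Rightarrow> real^3) \<Rightarrow> real^3 \<Rightarrow> bool" where
  "rectifying_helix_with I \<alpha> W V \<longleftrightarrow> helix_with I \<alpha> W V \<and> rectifying_field I \<alpha> W"

definition cylindrical_helix :: "real set \<Rightarrow> (real \<Rightarrow> real^3) \<Rightarrow> bool" where
  "cylindrical_helix I \<alpha> \<longleftrightarrow> (\<exists>V. V \<noteq> 0 \<and> constant_angle I (tangent \<alpha>) V)"

end

theory Submission
  imports Defs
begin

text \<open>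
  Write \<open>T\<close>, \<open>N\<close>, \<open>B\<close> for the Frenet frame and \<open>D\<close> for the Darboux vector.  Everything rests on two
  facts: \<open>T\<close> and \<open>N\<close> move by \<open>X' = D \<times> X\<close>, and \<open>D\<close> is orthogonal to \<open>N\<close> and nowhere zero.

  If \<open>\<langle>T, V\<rangle>\<close> is constant for a unit vector \<open>V\<close>, differentiating twice makes \<open>V\<close> orthogonal
  to \<open>N\<close> and to \<open>D \<times> N\<close>, so \<open>V\<close> is parallel to \<open>D\<close> and the constant field \<open>V\<close> is itself
  \<open>F\<close>-constant.  Hence so is the component of \<open>T\<close> orthogonal to \<open>V\<close>; it has constant nonzero length,
  and its normalization is the wanted field \<open>W\<close>.

  Conversely, let \<open>W\<close> be a unit \<open>F\<close>-constant rectifying field orthogonal to \<open>V\<close>.  Both \<open>D\<close> and \<open>W\<close>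
  are orthogonal to \<open>N\<close>, so \<open>W' = h N\<close>, and \<open>\<langle>W', V\<rangle> = 0\<close> becomes \<open>h \<langle>N, V\<rangle> = 0\<close> at every
  parameter.  If \<open>h\<close> vanishes identically, then \<open>W\<close> is constant and is an axis for \<open>T\<close>; if
  \<open>\<langle>N, V\<rangle>\<close> vanishes identically, then \<open>\<langle>T, V\<rangle>\<close> is constant and \<open>V\<close> is an axis.  The point is to
  exclude a mixture of the two cases.  The zero set of \<open>h\<close> is closed because \<open>W'\<close> is continuous.
  It is also open: at a zero of \<open>h\<close> the vectors \<open>D\<close> and \<open>W\<close> are parallel, so \<open>D \<times> N\<close> is a
  nonzero multiple of \<open>W \<times> N\<close>; since \<open>V\<close> is orthogonal to \<open>W\<close>, either \<open>\<langle>N, V\<rangle>\<close> or its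
  derivative \<open>\<langle>D \<times> N, V\<rangle>\<close> is nonzero there, and so \<open>\<langle>N, V\<rangle> \<noteq> 0\<close> at all nearby
  parameters, which forces \<open>h = 0\<close> at them.  As \<open>I\<close> is connected, \<open>h\<close> vanishes everywhere or nowhere.
\<close>

section \<open>Vectors in three-space\<close>

unbundle cross3_syntax

lemma orthonormal_expansion:
  fixes u v x :: "real^3"
  assumes u: "u \<bullet> u = 1" and v: "v \<bullet> v = 1" and uv: "u \<bullet> v = 0"
  shows "x = (x \<bullet> u) *\<^sub>R u + (x \<bullet> v) *\<^sub>R v + (x \<bullet> (u \<times> v)) *\<^sub>R (u \<times> v)"
proof -
  define b where "b = u \<times> v"
  have vu: "v \<bullet> u = 0" using uv by (simp add: inner_commute)
  have bb: "b \<bullet> b = 1" unfolding b_def by (simp add: dot_cross u v uv vu)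
  have b0: "u \<bullet> b = 0" "v \<bullet> b = 0" "b \<bullet> u = 0" "b \<bullet> v = 0"
    unfolding b_def by (simp_all add: dot_cross_self)
  define y where "y = x - ((x \<bullet> u) *\<^sub>R u + (x \<bullet> v) *\<^sub>R v + (x \<bullet> b) *\<^sub>R b)"
  have yu: "y \<bullet> u = 0" and yv: "y \<bullet> v = 0" and yb: "y \<bullet> b = 0"
    by (simp_all add: y_def inner_diff_left inner_add_left u v uv vu bb b0)
  have "y \<times> b = 0" unfolding b_def Lagrange by (simp add: yu yv)
  with yb have "y = 0 \<or> b = 0" using norm_and_cross_eq_0 by blast
  with bb have "y = 0" by auto
  then show ?thesis by (simp add: y_def b_def)
qed

lemma cross_of_perp:
  fixes n u v :: "real^3"
  assumes "n \<bullet> n = 1" "u \<bullet> n = 0" "v \<bullet> n = 0"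
  shows "u \<times> v = ((u \<times> v) \<bullet> n) *\<^sub>R n"
proof -
  have "n \<times> (u \<times> v) = 0"
    using assms by (simp add: Lagrange inner_commute)
  then have "n \<times> ((u \<times> v) \<times> n) = 0" by (simp add: cross_skew[of "u \<times> v" n])
  then show ?thesis
    using assms(1) unfolding Lagrange[of n "u \<times> v" n] by (simp add: inner_commute)
qed

lemma constant_angle_unit_iff:
  assumes unit: "\<forall>s\<in>I. norm (X s) = 1" and V: "V \<noteq> 0"
  shows "constant_angle I X V \<longleftrightarrow> (\<exists>c. \<forall>s\<in>I. X s \<bullet> V = c)"
proof
  assume "constant_angle I X V"
  then obtain \<theta> where \<theta>: "\<And>s. s \<in> I \<Longrightarrow> arccos (X s \<bullet> V / norm V) = \<theta>"
    using unit by (auto simp: constant_angle_def vec_angle_def)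
  have "\<bar>X s \<bullet> V / norm V\<bar> \<le> 1" if "s \<in> I" for s
    using Cauchy_Schwarz_ineq2[of "X s" V] unit that V by (simp add: field_simps)
  then have "X s \<bullet> V / norm V = cos \<theta>" if "s \<in> I" for s
    using \<theta>[OF that] cos_arccos_abs that by metis
  then have "X s \<bullet> V = cos \<theta> * norm V" if "s \<in> I" for s
    using that V by (simp add: field_simps)
  then show "\<exists>c. \<forall>s\<in>I. X s \<bullet> V = c" by blast
next
  assume "\<exists>c. \<forall>s\<in>I. X s \<bullet> V = c"
  then show "constant_angle I X V"
    using unit by (auto simp: constant_angle_def vec_angle_def)
qed

section \<open>Derivatives of vector-valued functions on an open interval\<close>

lemma inner_has_vector_derivative:
  assumes "(f has_vector_derivative f') (at s)" "(g has_vector_derivative g') (at s)"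
  shows "((\<lambda>t. f t \<bullet> g t) has_vector_derivative (f s \<bullet> g' + f' \<bullet> g s)) (at s)"
  by (rule bounded_bilinear.has_vector_derivative[OF bounded_bilinear_inner assms])

lemma constant_inner_derivative:
  assumes "open I" "s \<in> I" and const: "\<And>t. t \<in> I \<Longrightarrow> f t \<bullet> g t = c"
    and f: "(f has_vector_derivative f') (at s)" and g: "(g has_vector_derivative g') (at s)"
  shows "f s \<bullet> g' + f' \<bullet> g s = 0"
proof -
  have "((\<lambda>t. f t \<bullet> g t) has_vector_derivative 0) (at s)"
    by (rule has_vector_derivative_transform_within_open[of "\<lambda>t. c" 0 s I])
       (use assms in auto)
  with inner_has_vector_derivative[OF f g] show ?thesis
    by (rule vector_derivative_unique_at)
qed

lemma zero_vector_derivative_constant: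
  assumes "convex I" and "\<And>s. s \<in> I \<Longrightarrow> (f has_vector_derivative 0) (at s)"
  shows "\<exists>c. \<forall>s\<in>I. f s = c"
proof -
  have "(f has_derivative (\<lambda>h. 0)) (at s within I)" if "s \<in> I" for s
    using assms(2)[OF that] unfolding has_vector_derivative_def
    by (simp add: has_derivative_at_withinI)
  then show ?thesis using has_derivative_zero_constant[OF assms(1)] by blast
qed

lemma smooth_on_vderiv: "smooth_on I f \<Longrightarrow> smooth_on I (vderiv f)"
  unfolding smooth_on_def
proof (intro allI ballI)
  fix n t assume *: "\<forall>n. \<forall>t\<in>I. (vderiv ^^ n) f differentiable at t" and "t \<in> I"
  then have "(vderiv ^^ Suc n) f differentiable at t" by blast
  then show "(vderiv ^^ n) (vderiv f) differentiable at t"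
    by (simp add: funpow_swap1)
qed

lemma smooth_on_vector_derivative:
  assumes "smooth_on I f" "s \<in> I"
  shows "(f has_vector_derivative vderiv f s) (at s)"
proof -
  have "(vderiv ^^ 0) f differentiable at s" using assms unfolding smooth_on_def by blast
  then show ?thesis by (simp add: vderiv_def vector_derivative_works[symmetric])
qed

text \<open>The field built from a cylindrical helix has the form \<open>k T + q\<close> with constant \<open>k\<close> and \<open>q\<close>,
  so this closure property is what makes it smooth.  The additive constant \<open>p\<close> in the proof is
  \<open>q\<close> for the function itself and \<open>0\<close> for all its derivatives; leaving it unspecified treats
  both cases alike.\<close>

lemma smooth_on_scale_translate:
  fixes f :: "real \<Rightarrow> 'a::real_normed_vector"
  assumes "open I" and f: "smooth_on I f"
  shows "smooth_on I (\<lambda>t. k *\<^sub>R f t + q)"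
proof -
  have diff: "\<forall>t\<in>I. (vderiv ^^ n) (\<lambda>t. k *\<^sub>R f t + q) differentiable (at t)" for n
  proof -
    have d: "((vderiv ^^ n) (\<lambda>t. k *\<^sub>R f t + q) has_vector_derivative
              k *\<^sub>R (vderiv ^^ Suc n) f t) (at t)"
      if p: "\<forall>t\<in>I. (vderiv ^^ n) (\<lambda>t. k *\<^sub>R f t + q) t = k *\<^sub>R (vderiv ^^ n) f t + p"
        and t: "t \<in> I" for n p t
    proof (rule has_vector_derivative_transform_within_open[OF _ \<open>open I\<close> t])
      have "((vderiv ^^ n) f has_vector_derivative (vderiv ^^ Suc n) f t) (at t)"
        using f t by (simp add: smooth_on_def vderiv_def vector_derivative_works[symmetric])
      then show "((\<lambda>t. k *\<^sub>R (vderiv ^^ n) f t + p) has_vector_derivative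
              k *\<^sub>R (vderiv ^^ Suc n) f t) (at t)"
        by (auto intro!: derivative_eq_intros)
    qed (use p in auto)
    have e: "\<exists>p. \<forall>t\<in>I. (vderiv ^^ n) (\<lambda>t. k *\<^sub>R f t + q) t = k *\<^sub>R (vderiv ^^ n) f t + p" for n
    proof (induction n)
      case 0
      show ?case by auto
    next
      case (Suc n)
      then obtain p where p: "\<forall>t\<in>I. (vderiv ^^ n) (\<lambda>t. k *\<^sub>R f t + q) t = k *\<^sub>R (vderiv ^^ n) f t + p"
        by blast
      have "(vderiv ^^ Suc n) (\<lambda>t. k *\<^sub>R f t + q) t = k *\<^sub>R (vderiv ^^ Suc n) f t + 0" if "t \<in> I" for t
        using vector_derivative_at[OF d[OF p that]] by (simp add: vderiv_def)
      then show ?case by blast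
    qed
    show "\<forall>t\<in>I. (vderiv ^^ n) (\<lambda>t. k *\<^sub>R f t + q) differentiable (at t)"
      using e[of n] d differentiableI_vector by blast
  qed
  from diff show ?thesis unfolding smooth_on_def by blast
qed

text \<open>Either continuity keeps \<open>f\<close> away from \<open>0\<close>, or \<open>s\<close> is a simple and hence isolated zero.\<close>

lemma eventually_nonzero_of_derivative:
  fixes f :: "real \<Rightarrow> real"
  assumes d: "(f has_vector_derivative d) (at s)" and nz: "f s \<noteq> 0 \<or> d \<noteq> 0"
  shows "eventually (\<lambda>t. f t \<noteq> 0) (at s)"
proof (cases "f s = 0")
  case False
  have "isCont f s" using d by (rule has_vector_derivative_continuous)
  then show ?thesis using False tendsto_imp_eventually_ne unfolding isCont_def by blast
next
  case True
  have "((\<lambda>t. (f t - f s) / (t - s)) \<longlongrightarrow> d) (at s)"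
    using d by (simp add: has_real_derivative_iff_has_vector_derivative[symmetric] has_field_derivative_iff)
  then have "eventually (\<lambda>t. (f t - f s) / (t - s) \<noteq> 0) (at s)"
    using nz True by (intro tendsto_imp_eventually_ne) auto
  then show ?thesis by (rule eventually_mono) (use True in auto)
qed

section \<open>The Frenet frame and the Darboux vector\<close>

locale frenet_curve =
  fixes I :: "real set" and \<alpha> :: "real \<Rightarrow> real^3"
  assumes I_open: "open I"
    and arclength: "arclength_curve I \<alpha>"
    and curvature_pos: "s \<in> I \<Longrightarrow> curvature \<alpha> s > 0"
begin

abbreviation T where "T \<equiv> tangent \<alpha>"
abbreviation N where "N \<equiv> normal \<alpha>"
abbreviation B where "B \<equiv> binormal \<alpha>"
abbreviation D where "D \<equiv> darboux \<alpha>"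

lemma T_smooth: "smooth_on I T"
proof -
  have "T = vderiv \<alpha>" by (rule ext) (simp add: tangent_def)
  then show ?thesis using arclength smooth_on_vderiv[of I \<alpha>] by (simp add: arclength_curve_def)
qed

lemma norm_T: "s \<in> I \<Longrightarrow> norm (T s) = 1"
  using arclength by (simp add: arclength_curve_def tangent_def)

lemma T_T: "s \<in> I \<Longrightarrow> T s \<bullet> T s = 1"
  using norm_T by (simp add: norm_eq_1)

lemma N_N: "s \<in> I \<Longrightarrow> N s \<bullet> N s = 1"
  using curvature_pos[of s] unfolding norm_eq_1[symmetric]
  by (simp add: normal_def curvature_def)

lemma T_derivative:
  assumes "s \<in> I"
  shows "(T has_vector_derivative curvature \<alpha> s *\<^sub>R N s) (at s)"
  using smooth_on_vector_derivative[OF T_smooth assms] curvature_pos[OF assms]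
  by (simp add: normal_def)

lemma T_N: assumes "s \<in> I" shows "T s \<bullet> N s = 0"
proof -
  have "T s \<bullet> (curvature \<alpha> s *\<^sub>R N s) + (curvature \<alpha> s *\<^sub>R N s) \<bullet> T s = 0"
    using constant_inner_derivative[OF I_open assms T_T T_derivative[OF assms] T_derivative[OF assms]] .
  then show ?thesis using curvature_pos[OF assms] by (simp add: inner_commute)
qed

lemma B_perp: "T s \<bullet> B s = 0" "N s \<bullet> B s = 0"
  by (simp_all add: binormal_def dot_cross_self)

lemma B_B: "s \<in> I \<Longrightarrow> B s \<bullet> B s = 1"
  using T_T T_N N_N by (simp add: binormal_def dot_cross)

lemma frame_expansion:
  "s \<in> I \<Longrightarrow> x = (x \<bullet> T s) *\<^sub>R T s + (x \<bullet> N s) *\<^sub>R N s + (x \<bullet> B s) *\<^sub>R B s"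
  unfolding binormal_def by (rule orthonormal_expansion) (simp_all add: T_T N_N T_N)

lemma rectifying_field_iff: "rectifying_field I \<alpha> W \<longleftrightarrow> (\<forall>s\<in>I. W s \<bullet> N s = 0)"
  unfolding rectifying_field_def
proof (intro ball_cong refl iffI)
  fix s assume s: "s \<in> I"
  {
    assume "W s \<in> span {T s, B s}"
    then show "W s \<bullet> N s = 0"
    proof (induction rule: span_induct)
      case base
      show ?case by (auto simp: subspace_def inner_add_left)
    qed (use T_N[OF s] B_perp[of s] in \<open>auto simp: inner_commute\<close>)
  next
    assume "W s \<bullet> N s = 0"
    then have "W s = (W s \<bullet> T s) *\<^sub>R T s + (W s \<bullet> B s) *\<^sub>R B s"
      using frame_expansion[OF s, of "W s"] by simp
    also have "\<dots> \<in> span {T s, B s}"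
      by (intro span_add span_scale span_base) auto
    finally show "W s \<in> span {T s, B s}" .
  }
qed

lemma frame_differentiable:
  assumes "s \<in> I"
  shows "N differentiable (at s)" "B differentiable (at s)"
proof -
  have T': "vderiv T differentiable (at s)" "T differentiable (at s)"
    using smooth_on_vector_derivative[OF smooth_on_vderiv[OF T_smooth] assms]
      T_derivative[OF assms] by (auto intro: differentiableI_vector)
  have "norm (vderiv T s) > 0" using curvature_pos[OF assms] by (simp add: curvature_def)
  then have nz: "vderiv T s \<noteq> 0" by auto
  have "(\<lambda>t. inverse (norm (vderiv T t))) differentiable (at s)"
    using nz differentiable_compose[OF differentiable_norm_at[OF nz] T'(1)]
    by (intro differentiable_inverse) auto
  then have "(\<lambda>t. inverse (norm (vderiv T t)) *\<^sub>R vderiv T t) differentiable (at s)"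
    by (rule differentiable_scaleR) (rule T'(1))
  then show N': "N differentiable (at s)"
    unfolding normal_def[abs_def] curvature_def[abs_def] .
  have "bounded_bilinear cross3"
    using bilinear_cross bilinear_conv_bounded_bilinear by blast
  then have "(\<lambda>t. T t \<times> N t) differentiable (at s)"
    by (rule differentiableI_vector[OF bounded_bilinear.has_vector_derivative[OF _
          T'(2)[unfolded vector_derivative_works] N'[unfolded vector_derivative_works]]])
  then show "B differentiable (at s)"
    by (simp add: binormal_def[abs_def])
qed

lemma D_N: "s \<in> I \<Longrightarrow> D s \<bullet> N s = 0"
  using T_N[of s] B_perp(2)[of s] by (simp add: darboux_def inner_add_left inner_commute[of "B s" "N s"])

text \<open>In an orthonormal frame \<open>B \<times> T = N\<close> and \<open>B \<times> N = - T\<close>.\<close>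

lemma D_cross_T: assumes "s \<in> I" shows "D s \<times> T s = curvature \<alpha> s *\<^sub>R N s"
proof -
  have "B s \<times> T s = - (T s \<times> (T s \<times> N s))" by (simp add: binormal_def cross_skew[of _ "T s"])
  also have "\<dots> = N s" using T_T T_N assms by (simp add: Lagrange)
  finally show ?thesis by (simp add: darboux_def cross_add_left cross_mult_left)
qed

lemma D_cross_N:
  assumes "s \<in> I" shows "D s \<times> N s = torsion \<alpha> s *\<^sub>R B s - curvature \<alpha> s *\<^sub>R T s"
proof -
  have "B s \<times> N s = - (N s \<times> (T s \<times> N s))" by (simp add: binormal_def cross_skew[of _ "N s"])
  also have "\<dots> = - T s" using N_N T_N assms by (simp add: Lagrange inner_commute)
  finally show ?thesis
    by (simp add: darboux_def cross_add_left cross_mult_left binormal_def)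
qed

lemma D_nonzero: "s \<in> I \<Longrightarrow> D s \<noteq> 0"
  using D_cross_T[of s] curvature_pos[of s] N_N[of s] by auto

text \<open>The components of \<open>N'\<close> in the frame come from differentiating the orthonormality relations;
  the component along \<open>B\<close> is the torsion because the torsion is read off from \<open>B'\<close>.\<close>

lemma N_derivative:
  assumes s: "s \<in> I" shows "(N has_vector_derivative D s \<times> N s) (at s)"
proof -
  define N' where "N' = vderiv N s"
  have N': "(N has_vector_derivative N') (at s)"
    and B': "(B has_vector_derivative vderiv B s) (at s)"
    using frame_differentiable[OF s]
    by (simp_all add: N'_def vderiv_def vector_derivative_works)
  have 1: "N' \<bullet> N s = 0"
    using constant_inner_derivative[OF I_open s N_N N' N'] by (simp add: inner_commute)
  have 2: "N' \<bullet> T s = - curvature \<alpha> s"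
    using constant_inner_derivative[OF I_open s T_N T_derivative[OF s] N'] N_N[OF s]
    by (simp add: inner_commute)
  have 3: "N' \<bullet> B s = torsion \<alpha> s"
    using constant_inner_derivative[OF I_open s B_perp(2) N' B']
    by (simp add: torsion_def inner_commute)
  have "N' = D s \<times> N s"
    using frame_expansion[OF s, of N'] by (simp add: 1 2 3 D_cross_N[OF s])
  with N' show ?thesis by simp
qed

section \<open>Cylindrical helices are rectifying helices\<close>

text \<open>Constancy of \<open>\<langle>T, V\<rangle>\<close> puts \<open>D\<close> and \<open>V\<close> in the plane orthogonal to \<open>N\<close>, where \<open>V\<close>
  is also orthogonal to \<open>D \<times> N\<close>, so it has to lie on the line of \<open>D\<close>.\<close>

lemma D_cross_axis:
  assumes c: "\<And>t. t \<in> I \<Longrightarrow> T t \<bullet> V = c" and s: "s \<in> I"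
  shows "D s \<times> V = 0" "N s \<bullet> V = 0"
proof -
  have V': "((\<lambda>_. V) has_vector_derivative 0) (at t)" for t by simp
  have NV: "N t \<bullet> V = 0" if "t \<in> I" for t
    using constant_inner_derivative[OF I_open that c T_derivative[OF that] V']
      curvature_pos[OF that] by simp
  have "(D s \<times> N s) \<bullet> V = 0"
    using constant_inner_derivative[OF I_open s NV N_derivative[OF s] V'] by simp
  then have "(D s \<times> V) \<bullet> N s = 0"
    using cross_triple[of "N s" "D s" V] by (simp add: cross_skew[of "D s" "N s"])
  with cross_of_perp[of "N s" "D s" V] N_N[OF s] D_N[OF s] NV[OF s]
  show "D s \<times> V = 0" by (simp add: inner_commute)
  show "N s \<bullet> V = 0" by (rule NV[OF s])
qed

lemma cylindrical_imp_rectifying: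
  assumes "cylindrical_helix I \<alpha>"
  shows "\<exists>W V. rectifying_helix_with I \<alpha> W V \<and> (\<forall>s\<in>I. W s \<bullet> V = 0)"
proof -
  obtain V\<^sub>0 c\<^sub>0 where V\<^sub>0: "V\<^sub>0 \<noteq> 0" and c\<^sub>0: "\<forall>t\<in>I. T t \<bullet> V\<^sub>0 = c\<^sub>0"
    using assms constant_angle_unit_iff[of I T] norm_T
    by (auto simp: cylindrical_helix_def)
  define V where "V = V\<^sub>0 /\<^sub>R norm V\<^sub>0"
  define c where "c = c\<^sub>0 / norm V\<^sub>0"
  have VV: "V \<bullet> V = 1" using V\<^sub>0 unfolding norm_eq_1[symmetric] by (simp add: V_def)
  then have V: "V \<noteq> 0" by auto
  have c: "T t \<bullet> V = c" if "t \<in> I" for t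
    using c\<^sub>0 that by (simp add: V_def c_def field_simps)
  have DV: "D s \<times> V = 0" "N s \<bullet> V = 0" if "s \<in> I" for s
    using D_cross_axis[of V c s] c that by blast+
  define r where "r = sqrt (1 - c\<^sup>2)"
  define W where "W = (\<lambda>t. (1 / r) *\<^sub>R T t + (- c / r) *\<^sub>R V)"
  have W_alt: "W t = (1 / r) *\<^sub>R (T t - c *\<^sub>R V)" for t
    by (simp add: W_def scaleR_diff_right)
  have len: "norm (T s - c *\<^sub>R V) = r" if "s \<in> I" for s
    unfolding norm_eq_sqrt_inner r_def
    using T_T[OF that] c[OF that] VV
    by (simp add: inner_diff_left inner_diff_right inner_commute power2_eq_square)
  \<comment> \<open>The component of \<open>T\<close> orthogonal to \<open>V\<close> has the same cross product with \<open>D\<close> as \<open>T\<close>,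
     namely the nonzero vector \<open>T'\<close>.\<close>
  have r: "r \<noteq> 0" if "s \<in> I" for s
  proof
    assume "r = 0"
    then have "T s = c *\<^sub>R V" using len[OF that] by simp
    then have "D s \<times> T s = 0" using DV(1)[OF that] by (simp add: cross_mult_right)
    then show False using D_cross_T[OF that] curvature_pos[OF that] N_N[OF that] by auto
  qed
  have norm_W: "norm (W s) = 1" if "s \<in> I" for s
  proof -
    have "r \<ge> 0" using len[OF that] norm_ge_zero by metis
    then show ?thesis using r[OF that] len[OF that] by (simp add: W_alt)
  qed
  have W_V: "W s \<bullet> V = 0" if "s \<in> I" for s
    using c[OF that] VV by (simp add: W_alt inner_diff_left)
  have W_smooth: "smooth_on I W"
    unfolding W_def by (rule smooth_on_scale_translate[OF I_open T_smooth])
  have W': "vderiv W s = D s \<times> W s" if "s \<in> I" for s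
  proof -
    have "(W has_vector_derivative (1 / r) *\<^sub>R (curvature \<alpha> s *\<^sub>R N s)) (at s)"
      unfolding W_def using T_derivative[OF that] by (auto intro!: derivative_eq_intros)
    then have "vderiv W s = (1 / r) *\<^sub>R (D s \<times> T s)"
      by (simp add: vderiv_def vector_derivative_at D_cross_T[OF that])
    then show ?thesis
      using DV(1)[OF that] by (simp add: W_def Cross3.right_diff_distrib cross_mult_right)
  qed
  have "rectifying_field I \<alpha> W"
    unfolding rectifying_field_iff
    using T_N DV(2) by (simp add: W_alt inner_diff_left inner_commute[of V])
  moreover have "constant_angle I W V"
    using constant_angle_unit_iff[of I W V] norm_W V W_V by blast
  ultimately have "rectifying_helix_with I \<alpha> W V"
    using W_smooth W' norm_W V
    by (simp add: rectifying_helix_with_def helix_with_def F_constant_def)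
  with W_V show ?thesis by blast
qed

section \<open>Rectifying helices are cylindrical helices\<close>

text \<open>At a parameter where \<open>W' = 0\<close> the vectors \<open>W\<close>, \<open>N\<close> and \<open>D \<times> N\<close> form an orthogonal basis,
  so \<open>V\<close>, being orthogonal to \<open>W\<close>, cannot be orthogonal to both others.\<close>

lemma stationary_transversal:
  assumes s: "s \<in> I" and w: "w \<bullet> w = 1" "w \<bullet> N s = 0" "w \<bullet> V = 0"
    and V: "V \<noteq> 0" and Dw: "D s \<times> w = 0"
  shows "N s \<bullet> V \<noteq> 0 \<or> (D s \<times> N s) \<bullet> V \<noteq> 0"
proof (rule ccontr)
  assume *: "\<not> (N s \<bullet> V \<noteq> 0 \<or> (D s \<times> N s) \<bullet> V \<noteq> 0)"
  have "w \<times> (D s \<times> w) = D s - (w \<bullet> D s) *\<^sub>R w" using w by (simp add: Lagrange)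
  with Dw have D: "D s = (w \<bullet> D s) *\<^sub>R w" by simp
  with D_nonzero[OF s] have nz: "w \<bullet> D s \<noteq> 0" by auto
  have "(D s \<times> N s) \<bullet> V = (w \<bullet> D s) * ((w \<times> N s) \<bullet> V)"
    by (subst D) (simp add: cross_mult_left)
  with nz * have "V \<bullet> (w \<times> N s) = 0" by (simp add: inner_commute)
  moreover have "V \<bullet> w = 0" "V \<bullet> N s = 0" using * w by (auto simp: inner_commute)
  ultimately have "V = 0"
    using orthonormal_expansion[OF w(1) N_N[OF s] w(2), of V] by simp
  with V show False by simp
qed

lemma rectifying_imp_cylindrical:
  assumes I_int: "is_interval I" and WV: "rectifying_helix_with I \<alpha> W V"
    and W_V: "\<forall>s\<in>I. W s \<bullet> V = 0"
  shows "cylindrical_helix I \<alpha>"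
proof -
  have W_smooth: "smooth_on I W" and V: "V \<noteq> 0"
    and W': "\<And>s. s \<in> I \<Longrightarrow> vderiv W s = D s \<times> W s"
    and norm_W: "\<And>s. s \<in> I \<Longrightarrow> norm (W s) = 1"
    and W_N: "\<And>s. s \<in> I \<Longrightarrow> W s \<bullet> N s = 0"
    using WV rectifying_field_iff
    by (auto simp: rectifying_helix_with_def helix_with_def F_constant_def)
  note W_deriv = smooth_on_vector_derivative[OF W_smooth]
  have conv: "convex I" using I_int by (rule is_interval_convex)
  have V': "((\<lambda>_. V) has_vector_derivative 0) (at t)" for t by simp
  have NV_deriv: "((\<lambda>t. N t \<bullet> V) has_vector_derivative (D s \<times> N s) \<bullet> V) (at s)" if "s \<in> I" for s
    using inner_has_vector_derivative[OF N_derivative[OF that] V'] by simp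
  have dichotomy: "vderiv W s = 0 \<or> N s \<bullet> V = 0" if "s \<in> I" for s
  proof -
    have par: "vderiv W s = (vderiv W s \<bullet> N s) *\<^sub>R N s"
      unfolding W'[OF that]
      by (rule cross_of_perp) (use that in \<open>simp_all add: N_N D_N W_N\<close>)
    have "vderiv W s \<bullet> V = 0"
      using constant_inner_derivative[OF I_open that _ W_deriv[OF that] V', of 0] W_V by simp
    then have "(vderiv W s \<bullet> N s) * (N s \<bullet> V) = 0" using par by (metis inner_scaleR_left)
    then show ?thesis using par by auto
  qed
  define A where "A = {s \<in> I. vderiv W s = 0}"
  have "continuous_on I (vderiv W)"
    using smooth_on_vector_derivative[OF smooth_on_vderiv[OF W_smooth]]
    by (intro continuous_at_imp_continuous_on ballI has_vector_derivative_continuous)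
  then have "closedin (top_of_set I) A"
    unfolding A_def by (rule continuous_closedin_preimage_constant)
  moreover have "openin (top_of_set I) A"
  proof -
    have "eventually (\<lambda>t. t \<in> A) (nhds s)" if "s \<in> A" for s
    proof -
      have s: "s \<in> I" and 0: "vderiv W s = 0" using that by (auto simp: A_def)
      have "N s \<bullet> V \<noteq> 0 \<or> (D s \<times> N s) \<bullet> V \<noteq> 0"
        by (rule stationary_transversal[of s "W s"])
           (use s 0 W'[OF s] norm_W[OF s] W_N[OF s] W_V V in \<open>auto simp: norm_eq_1\<close>)
      then have "eventually (\<lambda>t. N t \<bullet> V \<noteq> 0) (at s)"
        by (rule eventually_nonzero_of_derivative[OF NV_deriv[OF s]])
      moreover have "eventually (\<lambda>t. t \<in> I) (at s)"
        using I_open s by (rule eventually_at_in_open')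
      ultimately have "eventually (\<lambda>t. t \<in> A) (at s)"
        by eventually_elim (use dichotomy in \<open>auto simp: A_def\<close>)
      then show ?thesis using that by (simp add: eventually_nhds_conv_at)
    qed
    then have "open A" unfolding eventually_nhds
      by (intro Topological_Spaces.openI) (meson subsetI)
    then show ?thesis using I_open by (simp add: openin_open_eq A_def)
  qed
  ultimately have "A = {} \<or> A = I"
    using connected_clopen convex_connected[OF conv] by blast
  then have "\<exists>U c. U \<noteq> 0 \<and> (\<forall>s\<in>I. T s \<bullet> U = c)"
  proof
    assume "A = {}"
    then have NV: "N s \<bullet> V = 0" if "s \<in> I" for s using dichotomy that by (auto simp: A_def)
    have "((\<lambda>t. T t \<bullet> V) has_vector_derivative 0) (at s)" if "s \<in> I" for s
      using inner_has_vector_derivative[OF T_derivative[OF that] V'] NV[OF that] by simp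
    then show ?thesis using zero_vector_derivative_constant[OF conv] V by blast
  next
    assume "A = I"
    then have 0: "vderiv W s = 0" if "s \<in> I" for s using that by (auto simp: A_def)
    obtain U where U: "\<forall>s\<in>I. W s = U"
      using zero_vector_derivative_constant[OF conv, of W] W_deriv 0 by metis
    have "((\<lambda>t. T t \<bullet> W t) has_vector_derivative 0) (at s)" if "s \<in> I" for s
      using inner_has_vector_derivative[OF T_derivative[OF that] W_deriv[OF that]]
        0[OF that] W_N[OF that] by (simp add: inner_commute)
    then obtain c where c: "\<forall>s\<in>I. T s \<bullet> W s = c"
      using zero_vector_derivative_constant[OF conv] by blast
    show ?thesis
    proof (cases "I = {}")
      case True
      then show ?thesis using V by auto
    next
      case False
      then have "U \<noteq> 0" using U norm_W by fastforce
      then show ?thesis using U c by auto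
    qed
  qed
  then show ?thesis
    using constant_angle_unit_iff[of I T] norm_T unfolding cylindrical_helix_def by blast
qed

end

theorem theorem4p1:
  fixes I :: "real set" and \<alpha> :: "real \<Rightarrow> real^3"
  assumes "open I" and "is_interval I"
    and "arclength_curve I \<alpha>"
    and "\<forall>s\<in>I. curvature \<alpha> s > 0"
  shows "(\<exists>W V. rectifying_helix_with I \<alpha> W V \<and> (\<forall>s\<in>I. W s \<bullet> V = 0))
           \<longleftrightarrow> cylindrical_helix I \<alpha>"
proof -
  interpret frenet_curve I \<alpha>
    by unfold_locales (use assms in auto)
  show ?thesis
    using rectifying_imp_cylindrical[OF assms(2)] cylindrical_imp_rectifying by blast
qed

end
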